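(* Let $(\Omega,\mathcal{F},P)$ be a probability space and let $\{X_n, n\ge 1\}$ be a sequence of real-valued random variables on it. Then the following three properties of $\{X_n,n\ge 1\}$ are equivalent: (UI) $\{X_n,n\ge1\}$ is uniformly integrable; (W-UI) $\{X_n,n\ge1\}$ is W-uniformly integrable; (W*-UI) $\{X_n,n\ge1\}$ is W*-uniformly integrable.
   Context: For a random variable $X$ and $A\in\mathcal{F}$, write $E(X:A)=E(XI_A)$, where $I_A$ is the indicator of $A$; expectations of nonnegative random variables take values in $[0,\infty]$. A sequence of random variables $\{X_n,n\ge 1\}$ on $(\Omega,\mathcal F,P)$ is called: - uniformly integrable (UI) if $\lim_{a\to\infty}\sup_{n\ge1}E(|X_n|:|X_n|\ge a)=0$; - W-uniformly integrable (W-UI) if $\lim_{a\to\infty}\sup_{n\ge1}E(|X_n|-a:|X_n|\ge a)=0$; - W*-uniformly integrable (W*-UI) if $\lim_{m\to\infty}\sup_{k\ge1}\sum_{n=m}^{\infty}P(|X_k|>n)=0$ ($m$ ranging over positive integers). *)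

theory Defs
  imports "HOL-Probability.Probability_Measure"
begin

text \<open>
  Sequences are indexed by the integers \<open>n \<ge> 1\<close>, so the value \<open>X 0\<close> is ignored.
  The expectation \<open>E(Y : A)\<close> of a random variable \<open>Y\<close> that is nonnegative on \<open>A\<close> is the
  nonnegative Lebesgue integral of \<open>Y\<close> over \<open>A\<close>, with values in \<open>[0, \<infinity>]\<close>; suprema, series and
  limits are accordingly taken in \<^typ>\<open>ennreal\<close>. Infinite values for small \<open>a\<close> or \<open>m\<close> are thus not
  excluded by convention. The random variables are real-valued, but need not be integrable.
\<close>

definition uniformly_integrable :: "'a measure \<Rightarrow> (nat \<Rightarrow> 'a \<Rightarrow> real) \<Rightarrow> bool" where
  "uniformly_integrable M X \<longleftrightarrow>
    ((\<lambda>a::real. SUP n\<in>{1..}.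
        \<integral>\<^sup>+\<omega>\<in>{\<omega> \<in> space M. a \<le> \<bar>X n \<omega>\<bar>}. ennreal \<bar>X n \<omega>\<bar> \<partial>M) \<longlongrightarrow> 0) at_top"

text \<open>
  In the next definition \<^const>\<open>ennreal\<close> does not truncate anything, because
  \<open>\<bar>X n \<omega>\<bar> - a\<close> is nonnegative on the domain of integration.
\<close>

definition W_uniformly_integrable :: "'a measure \<Rightarrow> (nat \<Rightarrow> 'a \<Rightarrow> real) \<Rightarrow> bool" where
  "W_uniformly_integrable M X \<longleftrightarrow>
    ((\<lambda>a::real. SUP n\<in>{1..}.
        \<integral>\<^sup>+\<omega>\<in>{\<omega> \<in> space M. a \<le> \<bar>X n \<omega>\<bar>}. ennreal (\<bar>X n \<omega>\<bar> - a) \<partial>M) \<longlongrightarrow> 0) at_top"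

text \<open>The sum over \<open>n \<ge> m\<close> is written as a series over \<open>j \<ge> 0\<close> with \<open>n = m + j\<close>.\<close>

definition W_star_uniformly_integrable :: "'a measure \<Rightarrow> (nat \<Rightarrow> 'a \<Rightarrow> real) \<Rightarrow> bool" where
  "W_star_uniformly_integrable M X \<longleftrightarrow>
    (\<lambda>m::nat. SUP k\<in>{1..}.
        \<Sum>j. emeasure M {\<omega> \<in> space M. \<bar>X k \<omega>\<bar> > real (m + j)}) \<longlonglongrightarrow> 0"

end

theory Submission
  imports Defs "HOL-Real_Asymp.Real_Asymp"
begin

text \<open>
  With \<open>U a\<close>, \<open>W a\<close> and \<open>S m\<close> the three suprema, the theorem follows by squeezing from
  \<open>W a \<le> U a \<le> 2 W (a/2)\<close> for \<open>a \<ge> 0\<close>, and from \<open>W a \<le> S \<lfloor>a\<rfloor>\<close> and \<open>S m \<le> W (m - 1)\<close>.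
  The last two hold because \<open>\<Sum>\<^bsub>n \<ge> m\<^esub> P(|X| > n)\<close> is the expectation of \<open>\<lceil>|X| - m\<rceil>\<^sup>+\<close>, which
  lies between \<open>(|X| - m)\<^sup>+\<close> and \<open>(|X| - m + 1)\<^sup>+\<close>.
\<close>

text \<open>Each probability is the integral of an indicator, and nonnegative terms allow the sum to
  move inside the integral. Pointwise, the sum then counts the \<open>j\<close> with
  \<open>m + j\<close> strictly below \<open>f\<close>.\<close>

lemma suminf_tail_emeasure:
  fixes f :: "'a \<Rightarrow> real"
  assumes [measurable]: "f \<in> borel_measurable M"
  shows "(\<Sum>j. emeasure M {\<omega> \<in> space M. f \<omega> > real (m + j)})
       = (\<integral>\<^sup>+\<omega>. of_nat (nat \<lceil>f \<omega> - real m\<rceil>) \<partial>M)"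
proof -
  have count: "(\<Sum>j. indicator {\<omega> \<in> space M. f \<omega> > real (m + j)} \<omega>)
      = (of_nat (nat \<lceil>f \<omega> - real m\<rceil>) :: ennreal)" if "\<omega> \<in> space M" for \<omega>
  proof -
    \<comment> \<open>Strictness of the inequality makes the count a ceiling: an integer lies below
      a real iff it lies below its ceiling. If \<open>f\<close> is at most \<open>m\<close>,
      \<open>nat\<close> truncates to 0, in agreement with the empty count.\<close>
    have "f \<omega> > real (m + j) \<longleftrightarrow> j < nat \<lceil>f \<omega> - real m\<rceil>" for j
      by (simp add: zless_nat_eq_int_zless less_ceiling_iff algebra_simps)
    then have "indicator {\<omega> \<in> space M. f \<omega> > real (m + j)} \<omega>
        = (indicator {..<nat \<lceil>f \<omega> - real m\<rceil>} j :: ennreal)" for j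
      using that unfolding indicator_def by auto
    then show ?thesis
      by (simp only:) (subst suminf_finite[of "{..<nat \<lceil>f \<omega> - real m\<rceil>}"], auto)
  qed
  have "(\<Sum>j. emeasure M {\<omega> \<in> space M. f \<omega> > real (m + j)})
      = (\<Sum>j. \<integral>\<^sup>+\<omega>. indicator {\<omega> \<in> space M. f \<omega> > real (m + j)} \<omega> \<partial>M)"
    by simp
  also have "\<dots> = (\<integral>\<^sup>+\<omega>. (\<Sum>j. indicator {\<omega> \<in> space M. f \<omega> > real (m + j)} \<omega>) \<partial>M)"
    by (rule nn_integral_suminf[symmetric]) measurable
  also have "\<dots> = (\<integral>\<^sup>+\<omega>. of_nat (nat \<lceil>f \<omega> - real m\<rceil>) \<partial>M)"
    by (intro nn_integral_cong count)
  finally show ?thesis .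
qed

text \<open>A ceiling is at least its argument, and lowering the threshold from \<open>a\<close> to
  \<open>m\<close> only increases the excess. Allowing a real \<open>a\<close> above
  \<open>m\<close> serves the later passage from real thresholds to integer ones.\<close>

lemma excess_le_suminf_tail_emeasure:
  fixes f :: "'a \<Rightarrow> real"
  assumes "f \<in> borel_measurable M" and "real m \<le> a"
  shows "(\<integral>\<^sup>+\<omega>\<in>{\<omega> \<in> space M. a \<le> f \<omega>}. ennreal (f \<omega> - a) \<partial>M)
       \<le> (\<Sum>j. emeasure M {\<omega> \<in> space M. f \<omega> > real (m + j)})"
  unfolding suminf_tail_emeasure[OF assms(1)]
proof (rule nn_integral_mono)
  fix \<omega>
  have "f \<omega> - a \<le> real (nat \<lceil>f \<omega> - real m\<rceil>)"
    using assms(2) by linarith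
  then have "ennreal (f \<omega> - a) \<le> of_nat (nat \<lceil>f \<omega> - real m\<rceil>)"
    unfolding ennreal_of_nat_eq_real_of_nat by (rule ennreal_leI)
  then show "ennreal (f \<omega> - a) * indicator {\<omega> \<in> space M. a \<le> f \<omega>} \<omega>
      \<le> of_nat (nat \<lceil>f \<omega> - real m\<rceil>)"
    by (simp add: indicator_def)
qed

text \<open>Rounding up adds less than 1, and the gap of 1 between \<open>a\<close> and
  \<open>m\<close> absorbs this.\<close>

lemma suminf_tail_emeasure_le_excess:
  fixes f :: "'a \<Rightarrow> real"
  assumes "f \<in> borel_measurable M" and "a \<le> real m - 1"
  shows "(\<Sum>j. emeasure M {\<omega> \<in> space M. f \<omega> > real (m + j)})
       \<le> (\<integral>\<^sup>+\<omega>\<in>{\<omega> \<in> space M. a \<le> f \<omega>}. ennreal (f \<omega> - a) \<partial>M)"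
  unfolding suminf_tail_emeasure[OF assms(1)]
proof (rule nn_integral_mono)
  fix \<omega> assume "\<omega> \<in> space M"
  show "of_nat (nat \<lceil>f \<omega> - real m\<rceil>)
      \<le> ennreal (f \<omega> - a) * indicator {\<omega> \<in> space M. a \<le> f \<omega>} \<omega>"
  \<comment> \<open>Where \<open>f\<close> is at most \<open>m\<close> the count is 0; elsewhere
    \<open>f\<close> exceeds \<open>a\<close>, so the indicator is 1.\<close>
  proof (cases "f \<omega> \<le> real m")
    case False
    then have "real (nat \<lceil>f \<omega> - real m\<rceil>) \<le> f \<omega> - a" "a \<le> f \<omega>"
      using assms(2) by linarith+
    then show ?thesis
      using \<open>\<omega> \<in> space M\<close> by (simp add: ennreal_of_nat_eq_real_of_nat ennreal_leI)
  qed simp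
qed

text \<open>Halving the threshold leaves an excess of at least half of \<open>f\<close>: if
  \<open>a\<close> is at most \<open>f\<close>, then \<open>f - a / 2\<close> is at least
  \<open>f / 2\<close>. Since \<open>0 \<le> a\<close>, the set for \<open>a\<close> lies inside the
  set for \<open>a / 2\<close>.\<close>

lemma tail_expectation_le_excess:
  fixes f :: "'a \<Rightarrow> real"
  assumes [measurable]: "f \<in> borel_measurable M" and "0 \<le> a"
  shows "(\<integral>\<^sup>+\<omega>\<in>{\<omega> \<in> space M. a \<le> f \<omega>}. ennreal (f \<omega>) \<partial>M)
       \<le> 2 * (\<integral>\<^sup>+\<omega>\<in>{\<omega> \<in> space M. a / 2 \<le> f \<omega>}. ennreal (f \<omega> - a / 2) \<partial>M)"
proof -
  have "ennreal (f \<omega>) * indicator {\<omega> \<in> space M. a \<le> f \<omega>} \<omega>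
      \<le> 2 * (ennreal (f \<omega> - a / 2) * indicator {\<omega> \<in> space M. a / 2 \<le> f \<omega>} \<omega>)" for \<omega>
  proof (cases "\<omega> \<in> space M \<and> a \<le> f \<omega>")
    case True
    then have "ennreal (f \<omega>) \<le> ennreal (2 * (f \<omega> - a / 2))"
      by (intro ennreal_leI) simp
    also have "\<dots> = 2 * ennreal (f \<omega> - a / 2)"
      by (subst ennreal_mult') simp_all
    finally show ?thesis
      using True assms(2) by simp
  qed (auto simp: indicator_def)
  then have "(\<integral>\<^sup>+\<omega>\<in>{\<omega> \<in> space M. a \<le> f \<omega>}. ennreal (f \<omega>) \<partial>M)
      \<le> (\<integral>\<^sup>+\<omega>. 2 * (ennreal (f \<omega> - a / 2) * indicator {\<omega> \<in> space M. a / 2 \<le> f \<omega>} \<omega>) \<partial>M)"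
    by (intro nn_integral_mono)
  also have "\<dots> = 2 * (\<integral>\<^sup>+\<omega>\<in>{\<omega> \<in> space M. a / 2 \<le> f \<omega>}. ennreal (f \<omega> - a / 2) \<partial>M)"
    by (rule nn_integral_cmult) measurable
  finally show ?thesis .
qed

lemma tendsto_0_le_ennreal:
  fixes f g :: "'b \<Rightarrow> ennreal"
  assumes "(g \<longlongrightarrow> 0) F" and "eventually (\<lambda>x. f x \<le> g x) F"
  shows "(f \<longlongrightarrow> 0) F"
  by (rule tendsto_sandwich[OF _ assms(2) tendsto_const assms(1)]) simp

theorem theorem2p1:
  fixes M :: "'a measure" and X :: "nat \<Rightarrow> 'a \<Rightarrow> real"
  assumes "prob_space M"
    and "\<And>n. n \<ge> 1 \<Longrightarrow> X n \<in> borel_measurable M"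
  shows "(uniformly_integrable M X \<longleftrightarrow> W_uniformly_integrable M X) \<and>
         (W_uniformly_integrable M X \<longleftrightarrow> W_star_uniformly_integrable M X)"
proof -
  define U where "U a = (SUP n\<in>{1..}.
      \<integral>\<^sup>+\<omega>\<in>{\<omega> \<in> space M. a \<le> \<bar>X n \<omega>\<bar>}. ennreal \<bar>X n \<omega>\<bar> \<partial>M)" for a :: real
  define W where "W a = (SUP n\<in>{1..}.
      \<integral>\<^sup>+\<omega>\<in>{\<omega> \<in> space M. a \<le> \<bar>X n \<omega>\<bar>}. ennreal (\<bar>X n \<omega>\<bar> - a) \<partial>M)" for a :: real
  define S where "S m = (SUP k\<in>{1..}.
      \<Sum>j. emeasure M {\<omega> \<in> space M. \<bar>X k \<omega>\<bar> > real (m + j)})" for m :: nat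
  \<comment> \<open>Nothing is assumed about \<open>X 0\<close>, hence the restriction of the
    index.\<close>
  have meas: "(\<lambda>\<omega>. \<bar>X n \<omega>\<bar>) \<in> borel_measurable M" if "n \<in> {1..}" for n
    using assms(2)[of n] that by simp
  have W_le_U: "W a \<le> U a" if "0 \<le> a" for a
    unfolding U_def W_def using that
    by (intro SUP_mono' nn_integral_mono mult_right_mono ennreal_leI) auto
  have U_le_W: "U a \<le> 2 * W (a / 2)" if "0 \<le> a" for a
    unfolding U_def W_def
    by (intro SUP_least order_trans[OF tail_expectation_le_excess[OF meas that]]
        mult_left_mono SUP_upper) auto
  \<comment> \<open>The sign condition matters: \<open>nat\<close> sends a negative floor to 0,
    which would exceed \<open>a\<close>.\<close>
  have W_le_S: "W a \<le> S (nat \<lfloor>a\<rfloor>)" if "0 \<le> a" for a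
    unfolding S_def W_def using that
    by (intro SUP_mono) (rule bexI, rule excess_le_suminf_tail_emeasure[OF meas], auto)
  \<comment> \<open>The case \<open>m = 0\<close> is no exception: the excess over the threshold -1
    is still a valid bound.\<close>
  have S_le_W: "S m \<le> W (real m - 1)" for m
    unfolding S_def W_def
    by (intro SUP_mono) (rule bexI, rule suminf_tail_emeasure_le_excess[OF meas], auto)
  have "(U \<longlongrightarrow> 0) at_top \<longleftrightarrow> (W \<longlongrightarrow> 0) at_top"
  proof
    assume "(U \<longlongrightarrow> 0) at_top"
    then show "(W \<longlongrightarrow> 0) at_top"
      by (rule tendsto_0_le_ennreal)
        (use eventually_ge_at_top[of 0] in \<open>rule eventually_mono\<close>, rule W_le_U)
  next
    assume W: "(W \<longlongrightarrow> 0) at_top"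
    have "filterlim (\<lambda>a::real. a / 2) at_top at_top"
      by real_asymp
    then have "((\<lambda>a. W (a / 2)) \<longlongrightarrow> 0) at_top"
      by (rule filterlim_compose[OF W])
    \<comment> \<open>The factor 2 is finite, so multiplication by it preserves limits in
      \<open>ennreal\<close>.\<close>
    then have "((\<lambda>a. 2 * W (a / 2)) \<longlongrightarrow> 2 * 0) at_top"
      by (intro ennreal_tendsto_cmult) auto
    then have "((\<lambda>a. 2 * W (a / 2)) \<longlongrightarrow> 0) at_top"
      by simp
    then show "(U \<longlongrightarrow> 0) at_top"
      by (rule tendsto_0_le_ennreal)
        (use eventually_ge_at_top[of 0] in \<open>rule eventually_mono\<close>, rule U_le_W)
  qed
  moreover have "(W \<longlongrightarrow> 0) at_top \<longleftrightarrow> S \<longlonglongrightarrow> 0"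
  proof
    assume W: "(W \<longlongrightarrow> 0) at_top"
    have "filterlim (\<lambda>m. real m - 1) at_top sequentially"
      using filterlim_tendsto_add_at_top[OF tendsto_const[of "-1"] filterlim_real_sequentially]
      by simp
    then have "(\<lambda>m. W (real m - 1)) \<longlonglongrightarrow> 0"
      by (rule filterlim_compose[OF W])
    then show "S \<longlonglongrightarrow> 0"
      by (rule tendsto_0_le_ennreal) (simp add: S_le_W)
  next
    assume S: "S \<longlonglongrightarrow> 0"
    \<comment> \<open>The floor turns the limit along the integers into one along the reals.\<close>
    have "filterlim (\<lambda>a::real. nat \<lfloor>a\<rfloor>) sequentially at_top"
      by (intro filterlim_compose[OF filterlim_nat_sequentially filterlim_floor_sequentially])
    then have "((\<lambda>a::real. S (nat \<lfloor>a\<rfloor>)) \<longlongrightarrow> 0) at_top"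
      by (rule filterlim_compose[OF S])
    then show "(W \<longlongrightarrow> 0) at_top"
      by (rule tendsto_0_le_ennreal)
        (use eventually_ge_at_top[of 0] in \<open>rule eventually_mono\<close>, rule W_le_S)
  qed
  ultimately show ?thesis
    unfolding uniformly_integrable_def W_uniformly_integrable_def
      W_star_uniformly_integrable_def U_def W_def S_def by blast
qed

end
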